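(* Let $\mathbf{C}$ be a preadditive category. Then the assignments $\mathcal{M}\mapsto\mathcal{M}^{\mathrm{r}}$ (restriction from $\mathbf{C}$ to $\mathbf{M}(\mathbf{C})$, from class (1) to class (2)) and $\mathcal{M}\mapsto\mathcal{M}^{\mathrm{e}}$ (extension from $\mathbf{M}(\mathbf{C})$ to $\mathbf{C}$, from class (2) to class (1)) define bijective correspondences between the following classes of ideals: (1) Maximal ideals of $\mathbf{C}$. (2) Maximal ideals $\mathcal{M}$ of $\mathbf{M}(\mathbf{C})$ satisfying $\mathcal{M}^{\mathrm{e}}(C,C)=\operatorname{End}_{\mathbf{C}}(C)$ for each object $C$ of $\mathbf{C}$ not belonging to $\mathbf{M}(\mathbf{C})\cup\mathbf{S}(\mathbf{C})$, that is, for each object $C$ for which there is no maximal object $N$ with $C\preceq N$.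
   Context: A preadditive category is a category with an abelian group structure on each hom-set such that composition is bilinear. An ideal $\mathcal{I}$ of a preadditive category $\mathbf{C}$ is an additive subfunctor of $\operatorname{Hom}_{\mathbf{C}}\colon\mathbf{C}^{op}\times\mathbf{C}\to\mathbf{Ab}$: it assigns to each pair of objects $A,B$ a subgroup $\mathcal{I}(A,B)$ of $\operatorname{Hom}_{\mathbf{C}}(A,B)$ such that $gif\in\mathcal{I}(X,Y)$ for all $f\colon X\to A$, $i\in\mathcal{I}(A,B)$, $g\colon B\to Y$. An ideal is maximal if it is proper (not equal to $\operatorname{Hom}_{\mathbf{C}}$) and is not properly contained in any other proper ideal. For objects $A,B$ of $\mathbf{C}$, write $A\prec B$ if there exists an infinite subset $E\subseteq \operatorname{Hom}_{\mathbf{C}}(B,A)\times\operatorname{Hom}_{\mathbf{C}}(A,B)$ such that (i) $fg=1_A$ for every $(f,g)\in E$; and (ii) for each $\varphi\in\operatorname{Hom}_{\mathbf{C}}(A,B)$, $|\{(f,g)\in E: f\varphi\neq 0\}|<|E|$. The relation $\prec$ is a strict order, and $A\preceq B$ means $A\prec B$ or $A=B$. An object is maximal (with respect to $\preceq$) if there is no object $B$ of $\mathbf{C}$ with $A\prec B$, where $A$ denotes the object in question. $\mathbf{M}(\mathbf{C})$ is the full subcategory of $\mathbf{C}$ consisting of all maximal objects with respect to $\preceq$. $\mathbf{S}(\mathbf{C})$ is the full subcategory of $\mathbf{C}$ whose objects are those $C$ for which there exists $A\in\mathbf{M}(\mathbf{C})$ with $C\prec A$. Given an object $A$ of $\mathbf{C}$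 and a two-sided ideal $I$ of $\operatorname{End}_{\mathbf{C}}(A)$, the ideal $\mathcal{A}_I$ of $\mathbf{C}$ associated to $I$ is defined by $\mathcal{A}_I(X,Y)=\{f\in\operatorname{Hom}_{\mathbf{C}}(X,Y):\beta f\alpha\in I\text{ for all }\alpha\in\operatorname{Hom}_{\mathbf{C}}(A,X),\ \beta\in\operatorname{Hom}_{\mathbf{C}}(Y,A)\}$. Let $\mathbf{D}$ be a full subcategory of $\mathbf{C}$. The restriction $\mathcal{I}^{\mathrm{r}}$ to $\mathbf{D}$ of an ideal $\mathcal{I}$ of $\mathbf{C}$ is given by $\mathcal{I}^{\mathrm{r}}(D,D')=\mathcal{I}(D,D')$ for all $D,D'\in\mathbf{D}$. The extension $\mathcal{M}^{\mathrm{e}}$ to $\mathbf{C}$ of a maximal ideal $\mathcal{M}$ of $\mathbf{D}$ is the ideal of $\mathbf{C}$ associated to $\mathcal{M}(D,D)$, where $D$ is any object of $\mathbf{D}$ with $\mathcal{M}(D,D)\neq\operatorname{End}_{\mathbf{D}}(D)$ (such a $D$ exists, and the resulting ideal does not depend on the choice of $D$). *)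

theory Defs
  imports "HOL-Algebra.Group"
begin

unbundle cardinal_syntax

text \<open>
  Composition, identities, addition and zero are indexed by objects, so hom-sets for different
  pairs of objects need not be disjoint. For \<open>f\<close> in \<open>Hom C X Y\<close> and \<open>g\<close> in \<open>Hom C Y Z\<close>, the
  composite \<open>g \<circ> f\<close> is \<open>Comp C X Y Z g f\<close>.
\<close>

record ('o, 'm) cat_data =
  Obj :: "'o set"
  Hom :: "'o \<Rightarrow> 'o \<Rightarrow> 'm set"
  Comp :: "'o \<Rightarrow> 'o \<Rightarrow> 'o \<Rightarrow> 'm \<Rightarrow> 'm \<Rightarrow> 'm"
  Ident :: "'o \<Rightarrow> 'm"
  Add :: "'o \<Rightarrow> 'o \<Rightarrow> 'm \<Rightarrow> 'm \<Rightarrow> 'm"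
  Zero :: "'o \<Rightarrow> 'o \<Rightarrow> 'm"

definition hom_group :: "('o, 'm) cat_data \<Rightarrow> 'o \<Rightarrow> 'o \<Rightarrow> 'm monoid" where
  "hom_group C X Y = \<lparr>carrier = Hom C X Y, mult = Add C X Y, one = Zero C X Y\<rparr>"

locale preadditive_category =
  fixes C :: "('o, 'm) cat_data"
  assumes comp_closed:
      "\<lbrakk>X \<in> Obj C; Y \<in> Obj C; Z \<in> Obj C; f \<in> Hom C X Y; g \<in> Hom C Y Z\<rbrakk>
        \<Longrightarrow> Comp C X Y Z g f \<in> Hom C X Z"
    and comp_assoc:
      "\<lbrakk>W \<in> Obj C; X \<in> Obj C; Y \<in> Obj C; Z \<in> Obj C;
        f \<in> Hom C W X; g \<in> Hom C X Y; h \<in> Hom C Y Z\<rbrakk>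
        \<Longrightarrow> Comp C W Y Z h (Comp C W X Y g f) = Comp C W X Z (Comp C X Y Z h g) f"
    and ident_closed: "X \<in> Obj C \<Longrightarrow> Ident C X \<in> Hom C X X"
    and comp_ident_left:
      "\<lbrakk>X \<in> Obj C; Y \<in> Obj C; f \<in> Hom C X Y\<rbrakk> \<Longrightarrow> Comp C X Y Y (Ident C Y) f = f"
    and comp_ident_right:
      "\<lbrakk>X \<in> Obj C; Y \<in> Obj C; f \<in> Hom C X Y\<rbrakk> \<Longrightarrow> Comp C X X Y f (Ident C X) = f"
    and hom_comm_group:
      "\<lbrakk>X \<in> Obj C; Y \<in> Obj C\<rbrakk> \<Longrightarrow> comm_group (hom_group C X Y)"
    and comp_add_left:
      "\<lbrakk>X \<in> Obj C; Y \<in> Obj C; Z \<in> Obj C; f \<in> Hom C X Y; g \<in> Hom C Y Z; g' \<in> Hom C Y Z\<rbrakk>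
        \<Longrightarrow> Comp C X Y Z (Add C Y Z g g') f
            = Add C X Z (Comp C X Y Z g f) (Comp C X Y Z g' f)"
    and comp_add_right:
      "\<lbrakk>X \<in> Obj C; Y \<in> Obj C; Z \<in> Obj C; f \<in> Hom C X Y; f' \<in> Hom C X Y; g \<in> Hom C Y Z\<rbrakk>
        \<Longrightarrow> Comp C X Y Z g (Add C X Y f f')
            = Add C X Z (Comp C X Y Z g f) (Comp C X Y Z g f')"

definition full_subcat :: "('o, 'm) cat_data \<Rightarrow> 'o set \<Rightarrow> ('o, 'm) cat_data" where
  "full_subcat C S = C\<lparr>Obj := S\<rparr>"

lemma full_subcat_simps [simp]:
  "Obj (full_subcat C S) = S"
  "Hom (full_subcat C S) = Hom C"
  "Comp (full_subcat C S) = Comp C"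
  "Ident (full_subcat C S) = Ident C"
  "Add (full_subcat C S) = Add C"
  "Zero (full_subcat C S) = Zero C"
  "hom_group (full_subcat C S) = hom_group C"
  by (simp_all add: full_subcat_def hom_group_def fun_eq_iff)

lemma (in preadditive_category) preadditive_full_subcat:
  assumes "S \<subseteq> Obj C"
  shows "preadditive_category (full_subcat C S)"
proof -
  have obj: "X \<in> Obj C" if "X \<in> S" for X
    using that assms by blast
  show ?thesis
    by (rule preadditive_category.intro, unfold full_subcat_simps)
      (rule comp_closed comp_assoc ident_closed comp_ident_left comp_ident_right
        hom_comm_group comp_add_left comp_add_right; (assumption | (rule obj, assumption)))+
qed

text \<open>
  An ideal is a family of subgroups indexed by pairs of objects. Its value at pairs not
  consisting of objects is fixed to be the empty set, so that equality and inclusion of ideals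
  as functions are equality and inclusion at all pairs of objects.
\<close>

definition cat_ideal :: "('o, 'm) cat_data \<Rightarrow> ('o \<Rightarrow> 'o \<Rightarrow> 'm set) \<Rightarrow> bool" where
  "cat_ideal C I \<longleftrightarrow>
     (\<forall>A\<in>Obj C. \<forall>B\<in>Obj C. subgroup (I A B) (hom_group C A B)) \<and>
     (\<forall>X\<in>Obj C. \<forall>A\<in>Obj C. \<forall>B\<in>Obj C. \<forall>Y\<in>Obj C.
        \<forall>f\<in>Hom C X A. \<forall>i\<in>I A B. \<forall>g\<in>Hom C B Y.
          Comp C X B Y g (Comp C X A B i f) \<in> I X Y) \<and>
     (\<forall>A B. A \<notin> Obj C \<or> B \<notin> Obj C \<longrightarrow> I A B = {})"

definition hom_ideal :: "('o, 'm) cat_data \<Rightarrow> 'o \<Rightarrow> 'o \<Rightarrow> 'm set" where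
  "hom_ideal C = (\<lambda>A B. if A \<in> Obj C \<and> B \<in> Obj C then Hom C A B else {})"

definition proper_ideal :: "('o, 'm) cat_data \<Rightarrow> ('o \<Rightarrow> 'o \<Rightarrow> 'm set) \<Rightarrow> bool" where
  "proper_ideal C I \<longleftrightarrow> cat_ideal C I \<and> I \<noteq> hom_ideal C"

definition maximal_ideal :: "('o, 'm) cat_data \<Rightarrow> ('o \<Rightarrow> 'o \<Rightarrow> 'm set) \<Rightarrow> bool" where
  "maximal_ideal C I \<longleftrightarrow> proper_ideal C I \<and> \<not> (\<exists>J. proper_ideal C J \<and> I < J)"

definition obj_prec :: "('o, 'm) cat_data \<Rightarrow> 'o \<Rightarrow> 'o \<Rightarrow> bool" where
  "obj_prec C A B \<longleftrightarrow>
     A \<in> Obj C \<and> B \<in> Obj C \<and>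
     (\<exists>E. E \<subseteq> Hom C B A \<times> Hom C A B \<and> infinite E \<and>
        (\<forall>(f, g)\<in>E. Comp C A B A f g = Ident C A) \<and>
        (\<forall>\<phi>\<in>Hom C A B. |{(f, g) \<in> E. Comp C A B A f \<phi> \<noteq> Zero C A A}| <o |E| ))"

definition obj_preceq :: "('o, 'm) cat_data \<Rightarrow> 'o \<Rightarrow> 'o \<Rightarrow> bool" where
  "obj_preceq C A B \<longleftrightarrow> obj_prec C A B \<or> A = B"

definition maximal_object :: "('o, 'm) cat_data \<Rightarrow> 'o \<Rightarrow> bool" where
  "maximal_object C A \<longleftrightarrow> A \<in> Obj C \<and> \<not> (\<exists>B\<in>Obj C. obj_prec C A B)"

definition M_cat :: "('o, 'm) cat_data \<Rightarrow> ('o, 'm) cat_data" where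
  "M_cat C = full_subcat C {A \<in> Obj C. maximal_object C A}"

definition S_cat :: "('o, 'm) cat_data \<Rightarrow> ('o, 'm) cat_data" where
  "S_cat C = full_subcat C {X \<in> Obj C. \<exists>A\<in>Obj (M_cat C). obj_prec C X A}"

lemma not_in_M_or_S_iff:
  assumes "X \<in> Obj C"
  shows "X \<notin> Obj (M_cat C) \<union> Obj (S_cat C)
    \<longleftrightarrow> \<not> (\<exists>N. maximal_object C N \<and> obj_preceq C X N)"
  using assms by (auto simp: M_cat_def S_cat_def maximal_object_def obj_preceq_def)

definition associated_ideal ::
  "('o, 'm) cat_data \<Rightarrow> 'o \<Rightarrow> 'm set \<Rightarrow> 'o \<Rightarrow> 'o \<Rightarrow> 'm set" where
  "associated_ideal C A I = (\<lambda>X Y. if X \<in> Obj C \<and> Y \<in> Obj C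
     then {f \<in> Hom C X Y. \<forall>\<alpha>\<in>Hom C A X. \<forall>\<beta>\<in>Hom C Y A.
             Comp C A Y A \<beta> (Comp C A X Y f \<alpha>) \<in> I}
     else {})"

text \<open>
  In the next two definitions, \<open>D\<close> is meant to be a full subcategory of \<open>C\<close>, and in the second
  one \<open>M\<close> is meant to be a maximal ideal of \<open>D\<close>. As \<open>M\<close> is proper, an object \<open>A\<close> of \<open>D\<close> with
  \<open>M A A \<noteq> Hom D A A\<close> exists; all such \<open>A\<close> give the same associated ideal of \<open>C\<close>, so the choice
  made by \<open>SOME\<close> is immaterial.
\<close>

definition restrict_ideal ::
  "('o, 'm) cat_data \<Rightarrow> ('o \<Rightarrow> 'o \<Rightarrow> 'm set) \<Rightarrow> 'o \<Rightarrow> 'o \<Rightarrow> 'm set" where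
  "restrict_ideal D I = (\<lambda>X Y. if X \<in> Obj D \<and> Y \<in> Obj D then I X Y else {})"

definition extend_ideal ::
  "('o, 'm) cat_data \<Rightarrow> ('o, 'm) cat_data \<Rightarrow> ('o \<Rightarrow> 'o \<Rightarrow> 'm set) \<Rightarrow> 'o \<Rightarrow> 'o \<Rightarrow> 'm set" where
  "extend_ideal C D M =
     (let A = (SOME A. A \<in> Obj D \<and> M A A \<noteq> Hom D A A) in associated_ideal C A (M A A))"

definition extension_covers_rest ::
  "('o, 'm) cat_data \<Rightarrow> ('o \<Rightarrow> 'o \<Rightarrow> 'm set) \<Rightarrow> bool" where
  "extension_covers_rest C M \<longleftrightarrow>
     (\<forall>X\<in>Obj C. X \<notin> Obj (M_cat C) \<union> Obj (S_cat C) \<longrightarrow>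
        extend_ideal C (M_cat C) M X X = Hom C X X)"

end

theory Submission
  imports Defs
begin

text \<open>
  If \<open>M\<close> is a maximal ideal and \<open>1\<^sub>A \<notin> M\<close>, then \<open>M\<close> is the ideal associated to \<open>M(A, A)\<close>,
  since the latter is proper and contains \<open>M\<close>. Moreover, for every object \<open>B\<close>, the identity of \<open>B\<close> is the sum of
  an element \<open>m\<close> of \<open>M\<close> and finitely many morphisms \<open>g\<^sub>i f\<^sub>i\<close> factoring through \<open>A\<close>. If \<open>A \<prec> B\<close>
  held, some pair \<open>(f, g)\<close> of the witnessing set would satisfy \<open>f g\<^sub>i = 0\<close> for all \<open>i\<close>, whence
  \<open>1\<^sub>A = f g = f m g \<in> M\<close>, a contradiction. So a maximal ideal of \<open>C\<close> contains the
  identities of all nonmaximal objects and is determined by its restriction to the maximal ones.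
  Conversely, an ideal containing the identities of all maximal objects contains those of the
  objects of \<open>S(C)\<close>, which are retracts of maximal objects; the extra condition in class (2) covers
  the remaining objects.
\<close>

section \<open>Inclusion, maximality, extension and restriction of families of morphisms\<close>

lemma ideal_le_hom_ideal:
  assumes "cat_ideal C I"
  shows "I \<le> hom_ideal C"
proof (intro le_funI)
  fix X Y
  show "I X Y \<subseteq> hom_ideal C X Y"
    using assms subgroup.subset[of "I X Y" "hom_group C X Y"]
    by (cases "X \<in> Obj C \<and> Y \<in> Obj C") (auto simp: cat_ideal_def hom_ideal_def hom_group_def)
qed

lemma maximal_ideal_eqI:
  assumes "maximal_ideal C M" "proper_ideal C J" "M \<le> J"
  shows "J = M"
  using assms unfolding maximal_ideal_def by (metis order_le_imp_less_or_eq)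

lemma maximal_imp_ideal: "maximal_ideal C M \<Longrightarrow> cat_ideal C M"
  by (simp add: maximal_ideal_def proper_ideal_def)

text \<open>Replaces the \<open>SOME\<close> in the extension by an object known only through its
  defining property. Later results hold for an arbitrary such object, so the choice never
  matters.\<close>

lemma extend_idealE:
  assumes "\<exists>A\<in>Obj D. M A A \<noteq> Hom D A A"
  obtains A where "A \<in> Obj D" "M A A \<noteq> Hom D A A"
    "extend_ideal C D M = associated_ideal C A (M A A)"
proof -
  define A where "A = (SOME A. A \<in> Obj D \<and> M A A \<noteq> Hom D A A)"
  have "A \<in> Obj D \<and> M A A \<noteq> Hom D A A"
    unfolding A_def by (rule someI_ex) (use assms in blast)
  moreover have "extend_ideal C D M = associated_ideal C A (M A A)"
    by (simp add: extend_ideal_def A_def Let_def)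
  ultimately show thesis using that by blast
qed

lemma restrict_ideal_apply:
  "X \<in> Obj D \<Longrightarrow> Y \<in> Obj D \<Longrightarrow> restrict_ideal D I X Y = I X Y"
  by (simp add: restrict_ideal_def)

lemma restrict_ideal_mono: "I \<le> J \<Longrightarrow> restrict_ideal D I \<le> restrict_ideal D J"
  by (auto simp: restrict_ideal_def le_fun_def)

text \<open>For an ideal \<open>M\<close> and an object \<open>A\<close>, this is the ideal
  generated by \<open>M\<close> and the identity of \<open>A\<close>. Negation and outer composition
  alter just one factor of each composite through \<open>A\<close>, so sums already yield an ideal.
  Asking for objects in \<open>factor\<close> keeps the values at other pairs empty.\<close>

inductive_set adjoin_object ::
    "('o, 'm) cat_data \<Rightarrow> ('o \<Rightarrow> 'o \<Rightarrow> 'm set) \<Rightarrow> 'o \<Rightarrow> 'o \<Rightarrow> 'o \<Rightarrow> 'm set"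
  for C M A X Y where
    base: "m \<in> M X Y \<Longrightarrow> m \<in> adjoin_object C M A X Y"
  | factor: "\<lbrakk>X \<in> Obj C; Y \<in> Obj C; f \<in> Hom C X A; g \<in> Hom C A Y\<rbrakk>
      \<Longrightarrow> Comp C X A Y g f \<in> adjoin_object C M A X Y"
  | add: "\<lbrakk>h \<in> adjoin_object C M A X Y; k \<in> adjoin_object C M A X Y\<rbrakk>
      \<Longrightarrow> Add C X Y h k \<in> adjoin_object C M A X Y"

context preadditive_category
begin

section \<open>Zero and negatives in the hom-groups\<close>

lemma group_hom: "X \<in> Obj C \<Longrightarrow> Y \<in> Obj C \<Longrightarrow> group (hom_group C X Y)"
  using hom_comm_group comm_group.axioms(2) by blast

lemma add_closed:
  assumes "X \<in> Obj C" "Y \<in> Obj C" "f \<in> Hom C X Y" "g \<in> Hom C X Y"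
  shows "Add C X Y f g \<in> Hom C X Y"
  using monoid.m_closed[OF group.is_monoid[OF group_hom[OF assms(1,2)]], of f g] assms
  by (simp add: hom_group_def)

lemma zero_closed:
  assumes "X \<in> Obj C" "Y \<in> Obj C"
  shows "Zero C X Y \<in> Hom C X Y"
  using monoid.one_closed[OF group.is_monoid[OF group_hom[OF assms(1,2)]]]
  by (simp add: hom_group_def)

lemma add_zero_left:
  assumes "X \<in> Obj C" "Y \<in> Obj C" "f \<in> Hom C X Y"
  shows "Add C X Y (Zero C X Y) f = f"
  using monoid.l_one[OF group.is_monoid[OF group_hom[OF assms(1,2)]], of f] assms
  by (simp add: hom_group_def)

text \<open>Bilinearity gives g 0 + g 0 = g (0 + 0) = g 0; this criterion turns that into g 0 = 0,
  and likewise on the other side.\<close>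

lemma add_idem_imp_zero:
  assumes "X \<in> Obj C" "Y \<in> Obj C" "f \<in> Hom C X Y" "Add C X Y f f = f"
  shows "f = Zero C X Y"
  using group.l_cancel_one'[OF group_hom[OF assms(1,2)], of f f] assms
  by (simp add: hom_group_def)

lemma comp_zero_right:
  assumes "X \<in> Obj C" "Y \<in> Obj C" "Z \<in> Obj C" "g \<in> Hom C Y Z"
  shows "Comp C X Y Z g (Zero C X Y) = Zero C X Z"
  using assms
  by (intro add_idem_imp_zero) (simp_all add: comp_closed zero_closed add_zero_left
      flip: comp_add_right)

lemma comp_zero_left:
  assumes "X \<in> Obj C" "Y \<in> Obj C" "Z \<in> Obj C" "f \<in> Hom C X Y"
  shows "Comp C X Y Z (Zero C Y Z) f = Zero C X Z"
  using assms
  by (intro add_idem_imp_zero) (simp_all add: comp_closed zero_closed add_zero_left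
      flip: comp_add_left)

lemma inv_closed:
  assumes "X \<in> Obj C" "Y \<in> Obj C" "f \<in> Hom C X Y"
  shows "inv\<^bsub>hom_group C X Y\<^esub> f \<in> Hom C X Y"
  using group.inv_closed[OF group_hom[OF assms(1,2)], of f] assms by (simp add: hom_group_def)

lemma add_inv_left:
  assumes "X \<in> Obj C" "Y \<in> Obj C" "f \<in> Hom C X Y"
  shows "Add C X Y (inv\<^bsub>hom_group C X Y\<^esub> f) f = Zero C X Y"
  using group.l_inv[OF group_hom[OF assms(1,2)], of f] assms by (simp add: hom_group_def)

lemma inv_eqI:
  assumes "X \<in> Obj C" "Y \<in> Obj C" "f \<in> Hom C X Y" "g \<in> Hom C X Y" "Add C X Y g f = Zero C X Y"
  shows "inv\<^bsub>hom_group C X Y\<^esub> f = g"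
  using group.inv_equality[OF group_hom[OF assms(1,2)], of g f] assms by (simp add: hom_group_def)

text \<open>Negatives are unique, and (-g) f + g f = 0 f = 0.\<close>

lemma inv_comp_left:
  assumes "X \<in> Obj C" "Y \<in> Obj C" "Z \<in> Obj C" "f \<in> Hom C X Y" "g \<in> Hom C Y Z"
  shows "inv\<^bsub>hom_group C X Z\<^esub> (Comp C X Y Z g f) = Comp C X Y Z (inv\<^bsub>hom_group C Y Z\<^esub> g) f"
  using assms by (intro inv_eqI)
    (simp_all add: comp_closed inv_closed add_inv_left comp_zero_left flip: comp_add_left)

lemma inv_comp_right:
  assumes "X \<in> Obj C" "Y \<in> Obj C" "Z \<in> Obj C" "f \<in> Hom C X Y" "g \<in> Hom C Y Z"
  shows "inv\<^bsub>hom_group C X Z\<^esub> (Comp C X Y Z g f) = Comp C X Y Z g (inv\<^bsub>hom_group C X Y\<^esub> f)"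
  using assms by (intro inv_eqI)
    (simp_all add: comp_closed inv_closed add_inv_left comp_zero_right flip: comp_add_right)

lemma inv_add:
  assumes "X \<in> Obj C" "Y \<in> Obj C" "f \<in> Hom C X Y" "g \<in> Hom C X Y"
  shows "inv\<^bsub>hom_group C X Y\<^esub> (Add C X Y f g)
    = Add C X Y (inv\<^bsub>hom_group C X Y\<^esub> f) (inv\<^bsub>hom_group C X Y\<^esub> g)"
  using comm_group.inv_mult[OF hom_comm_group[OF assms(1,2)], of f g] assms(3,4)
  by (simp add: hom_group_def)

section \<open>Closure properties of ideals and tests for being everything\<close>

lemma ideal_subset:
  assumes "cat_ideal C I" "i \<in> I X Y"
  shows "X \<in> Obj C" "Y \<in> Obj C" "i \<in> Hom C X Y"
  using ideal_le_hom_ideal[OF assms(1), THEN le_funD, THEN le_funD, of X Y] assms(2)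
  by (auto simp: hom_ideal_def split: if_splits)

lemma ideal_subgroup:
  assumes "cat_ideal C I" "X \<in> Obj C" "Y \<in> Obj C"
  shows "subgroup (I X Y) (hom_group C X Y)"
  using assms by (simp add: cat_ideal_def)

lemma ideal_zero:
  assumes "cat_ideal C I" "X \<in> Obj C" "Y \<in> Obj C"
  shows "Zero C X Y \<in> I X Y"
  using subgroup.one_closed[OF ideal_subgroup[OF assms]] by (simp add: hom_group_def)

lemma ideal_add:
  assumes "cat_ideal C I" "f \<in> I X Y" "g \<in> I X Y"
  shows "Add C X Y f g \<in> I X Y"
  using subgroup.m_closed[OF ideal_subgroup[OF assms(1) ideal_subset(1,2)[OF assms(1,2)]] assms(2,3)]
  by (simp add: hom_group_def)

lemma ideal_inv:
  assumes "cat_ideal C I" "f \<in> I X Y"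
  shows "inv\<^bsub>hom_group C X Y\<^esub> f \<in> I X Y"
  by (rule subgroup.m_inv_closed[OF ideal_subgroup[OF assms(1) ideal_subset(1,2)[OF assms]] assms(2)])

lemma ideal_comp:
  assumes "cat_ideal C I" "X \<in> Obj C" "Y \<in> Obj C" "f \<in> Hom C X A" "i \<in> I A B" "g \<in> Hom C B Y"
  shows "Comp C X B Y g (Comp C X A B i f) \<in> I X Y"
  using assms(1) assms ideal_subset[OF assms(1,5)] unfolding cat_ideal_def by blast

lemma ideal_comp_left:
  assumes "cat_ideal C I" "Y \<in> Obj C" "i \<in> I A B" "g \<in> Hom C B Y"
  shows "Comp C A B Y g i \<in> I A Y"
  using ideal_comp[OF assms(1) _ assms(2) ident_closed assms(3,4)]
    ideal_subset[OF assms(1,3)] comp_ident_right[of A B i] by simp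

lemma ideal_comp_right:
  assumes "cat_ideal C I" "X \<in> Obj C" "i \<in> I A B" "f \<in> Hom C X A"
  shows "Comp C X A B i f \<in> I X B"
  using ideal_comp[OF assms(1,2) _ assms(4,3) ident_closed]
    ideal_subset[OF assms(1,3)] assms comp_ident_left[of X B "Comp C X A B i f"]
  by (simp add: comp_closed)

text \<open>Splits two-sided closure under composition into two one-sided conditions, which are
  easier to verify. The first premise also gives emptiness at pairs not consisting of
  objects.\<close>

lemma cat_idealI:
  assumes "\<And>X Y f. f \<in> I X Y \<Longrightarrow> X \<in> Obj C \<and> Y \<in> Obj C \<and> f \<in> Hom C X Y"
    and "\<And>X Y. X \<in> Obj C \<Longrightarrow> Y \<in> Obj C \<Longrightarrow> Zero C X Y \<in> I X Y"
    and "\<And>X Y f g. f \<in> I X Y \<Longrightarrow> g \<in> I X Y \<Longrightarrow> Add C X Y f g \<in> I X Y"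
    and "\<And>X Y f. f \<in> I X Y \<Longrightarrow> inv\<^bsub>hom_group C X Y\<^esub> f \<in> I X Y"
    and "\<And>X A B f i. X \<in> Obj C \<Longrightarrow> f \<in> Hom C X A \<Longrightarrow> i \<in> I A B \<Longrightarrow> Comp C X A B i f \<in> I X B"
    and "\<And>A B Y i g. Y \<in> Obj C \<Longrightarrow> i \<in> I A B \<Longrightarrow> g \<in> Hom C B Y \<Longrightarrow> Comp C A B Y g i \<in> I A Y"
  shows "cat_ideal C I"
  unfolding cat_ideal_def
proof (intro conjI ballI allI impI)
  fix A B assume "A \<in> Obj C" "B \<in> Obj C"
  then show "subgroup (I A B) (hom_group C A B)"
    using assms(1)[of _ A B] assms(2)[of A B] assms(3)[of _ A B] assms(4)[of _ A B]
    by (intro group.subgroupI[OF group_hom]) (auto simp: hom_group_def)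
qed (use assms(1,5,6) in blast)+

text \<open>Every endomorphism is f = f 1_A, so properness at an object is a question about one
  identity.\<close>

lemma ideal_eq_hom_iff:
  assumes "cat_ideal C I" "A \<in> Obj C"
  shows "I A A = Hom C A A \<longleftrightarrow> Ident C A \<in> I A A"
proof
  show "Ident C A \<in> I A A" if "I A A = Hom C A A"
    using that ident_closed assms by simp
next
  assume id: "Ident C A \<in> I A A"
  have "f \<in> I A A" if "f \<in> Hom C A A" for f
    using ideal_comp_left[OF assms(1,2) id that] comp_ident_right assms that by simp
  then show "I A A = Hom C A A"
    using ideal_subset(3)[OF assms(1)] by blast
qed

lemma ideal_eq_hom_idealI:
  assumes "cat_ideal C I" "\<And>X. X \<in> Obj C \<Longrightarrow> Ident C X \<in> I X X"
  shows "I = hom_ideal C"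
proof (rule antisym[OF ideal_le_hom_ideal[OF assms(1)]], intro le_funI subsetI)
  fix X Y f assume "f \<in> hom_ideal C X Y"
  then have f: "X \<in> Obj C" "Y \<in> Obj C" "f \<in> Hom C X Y"
    by (auto simp: hom_ideal_def split: if_splits)
  show "f \<in> I X Y"
    using ideal_comp_left[OF assms(1) f(2) assms(2)[OF f(1)] f(3)] comp_ident_right f by simp
qed

text \<open>An ideal containing all identities is everything, so properness is always visible on
  some endomorphism ring.\<close>

lemma proper_idealE:
  assumes "proper_ideal C I"
  obtains A where "A \<in> Obj C" "I A A \<noteq> Hom C A A"
  using assms ideal_eq_hom_idealI ideal_eq_hom_iff unfolding proper_ideal_def by metis

lemma proper_idealI:
  assumes "cat_ideal C I" "A \<in> Obj C" "I A A \<noteq> Hom C A A"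
  shows "proper_ideal C I"
  using assms by (auto simp: proper_ideal_def hom_ideal_def)

section \<open>Associated ideals and their relation to maximal ideals\<close>

lemma ideal_associated:
  assumes K: "subgroup K (hom_group C A A)" and A: "A \<in> Obj C"
  shows "cat_ideal C (associated_ideal C A K)"
proof (rule cat_idealI)
  have K_add: "Add C A A f g \<in> K" if "f \<in> K" "g \<in> K" for f g
    using subgroup.m_closed[OF K that] by (simp add: hom_group_def)
  have K_zero: "Zero C A A \<in> K"
    using subgroup.one_closed[OF K] by (simp add: hom_group_def)
  show "Add C X Y f g \<in> associated_ideal C A K X Y"
    if "f \<in> associated_ideal C A K X Y" "g \<in> associated_ideal C A K X Y" for X Y f g
    using that A K_add
    by (auto simp: associated_ideal_def add_closed comp_add_left comp_add_right comp_closed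
        split: if_splits)
  show "inv\<^bsub>hom_group C X Y\<^esub> f \<in> associated_ideal C A K X Y"
    if "f \<in> associated_ideal C A K X Y" for X Y f
    using that A subgroup.m_inv_closed[OF K]
    by (auto simp: associated_ideal_def inv_closed comp_closed
        simp flip: inv_comp_left inv_comp_right split: if_splits)
  show "Comp C X U V i f \<in> associated_ideal C A K X V"
    if X: "X \<in> Obj C" and f: "f \<in> Hom C X U" and i: "i \<in> associated_ideal C A K U V"
    for X U V f i
  proof -
    have UV: "U \<in> Obj C" "V \<in> Obj C" "i \<in> Hom C U V"
      using i by (auto simp: associated_ideal_def split: if_splits)
    \<comment> \<open>The inner factor \<open>f\<close> is absorbed into the test morphism:
      membership of \<open>i\<close> is tested with f \<alpha> in place of \<alpha>.\<close>
    have "Comp C A V A \<beta> (Comp C A X V (Comp C X U V i f) \<alpha>)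
        = Comp C A V A \<beta> (Comp C A U V i (Comp C A X U f \<alpha>))"
      if "\<alpha> \<in> Hom C A X" for \<alpha> \<beta>
      using that X A f UV by (simp add: comp_assoc)
    then show ?thesis
      using X A f i UV by (simp add: associated_ideal_def comp_closed)
  qed
  show "Comp C U V Y g i \<in> associated_ideal C A K U Y"
    if Y: "Y \<in> Obj C" and i: "i \<in> associated_ideal C A K U V" and g: "g \<in> Hom C V Y"
    for U V Y i g
  proof -
    have UV: "U \<in> Obj C" "V \<in> Obj C" "i \<in> Hom C U V"
      using i by (auto simp: associated_ideal_def split: if_splits)
    have "Comp C A Y A \<beta> (Comp C A U Y (Comp C U V Y g i) \<alpha>)
        = Comp C A V A (Comp C V Y A \<beta> g) (Comp C A U V i \<alpha>)"
      if "\<alpha> \<in> Hom C A U" "\<beta> \<in> Hom C Y A" for \<alpha> \<beta>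
      using that Y A g UV by (simp add: comp_closed flip: comp_assoc)
    then show ?thesis
      using Y A g i UV by (simp add: associated_ideal_def comp_closed)
  qed
  show "Zero C X Y \<in> associated_ideal C A K X Y" if "X \<in> Obj C" "Y \<in> Obj C" for X Y
    using that A K_zero
    by (simp add: associated_ideal_def zero_closed comp_zero_left comp_zero_right)
qed (auto simp: associated_ideal_def split: if_splits)

text \<open>For f in \<open>I\<close>, every composite \<beta> f \<alpha> lies in
  \<open>I A A\<close>, hence in \<open>K\<close>. So the associated ideal bounds all ideals whose
  value at \<open>A\<close> is inside \<open>K\<close>.\<close>

lemma ideal_le_associated:
  assumes "cat_ideal C I" "A \<in> Obj C" "I A A \<subseteq> K"
  shows "I \<le> associated_ideal C A K"
  using ideal_subset[OF assms(1)] ideal_comp[OF assms(1,2,2)] assms(3)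
  unfolding le_fun_def associated_ideal_def by (simp add: subset_iff)

lemma associated_neq_hom:
  assumes "A \<in> Obj C" "Ident C A \<notin> K"
  shows "associated_ideal C A K A A \<noteq> Hom C A A"
proof
  note id = ident_closed[OF assms(1)]
  assume "associated_ideal C A K A A = Hom C A A"
  then have "Ident C A \<in> associated_ideal C A K A A"
    using id by simp
  \<comment> \<open>Both test morphisms are taken to be the identity.\<close>
  then have "Comp C A A A (Ident C A) (Comp C A A A (Ident C A) (Ident C A)) \<in> K"
    using id assms(1) unfolding associated_ideal_def by simp
  then show False
    using assms id comp_ident_left[OF assms(1,1) id] by simp
qed

text \<open>The associated ideal is proper and contains \<open>M\<close>. A general \<open>K\<close>
  above \<open>M A A\<close> is allowed because the result is later applied to the value at
  \<open>A\<close> of an ideal larger than a restriction of \<open>M\<close>.\<close>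

lemma maximal_ideal_eq_associated:
  assumes max: "maximal_ideal C M" and A: "A \<in> Obj C"
    and K: "subgroup K (hom_group C A A)" "M A A \<subseteq> K" "Ident C A \<notin> K"
  shows "associated_ideal C A K = M"
proof (rule maximal_ideal_eqI[OF max])
  show "proper_ideal C (associated_ideal C A K)"
    using proper_idealI[OF ideal_associated[OF K(1) A] A associated_neq_hom[OF A K(3)]] .
  show "M \<le> associated_ideal C A K"
    using ideal_le_associated[OF maximal_imp_ideal[OF max] A K(2)] .
qed

lemma maximal_ideal_eq_associated_self:
  assumes "maximal_ideal C M" "A \<in> Obj C" "M A A \<noteq> Hom C A A"
  shows "associated_ideal C A (M A A) = M"
  using maximal_ideal_eq_associated[OF assms(1,2)] ideal_subgroup[of M A A]
    ideal_eq_hom_iff[of M A] maximal_imp_ideal[OF assms(1)] assms(2,3) by simp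

section \<open>Adjoining the identity of an object to an ideal\<close>

lemma ideal_adjoin_object:
  assumes M: "cat_ideal C M" and A: "A \<in> Obj C"
  shows "cat_ideal C (adjoin_object C M A)"
proof -
  have sub: "X \<in> Obj C \<and> Y \<in> Obj C \<and> h \<in> Hom C X Y" if "h \<in> adjoin_object C M A X Y" for X Y h
    using that
    by induction (use ideal_subset[OF M] A comp_closed add_closed in blast)+
  show ?thesis
  proof (rule cat_idealI)
    show "Zero C X Y \<in> adjoin_object C M A X Y" if "X \<in> Obj C" "Y \<in> Obj C" for X Y
      using ideal_zero[OF M that] by (rule adjoin_object.base)
    show "inv\<^bsub>hom_group C X Y\<^esub> h \<in> adjoin_object C M A X Y"
      if "h \<in> adjoin_object C M A X Y" for X Y h
      using that
    proof induction
      case (base m)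
      then show ?case using ideal_inv[OF M] adjoin_object.base by metis
    next
      case (factor f g)
      then show ?case
        using A by (simp add: inv_comp_left inv_closed adjoin_object.factor)
    next
      case (add h k)
      then show ?case using sub by (simp add: inv_add adjoin_object.add)
    qed
    show "Comp C X U V i f \<in> adjoin_object C M A X V"
      if X: "X \<in> Obj C" and f: "f \<in> Hom C X U" and i: "i \<in> adjoin_object C M A U V" for X U V f i
      using i
    proof induction
      case (base m)
      then show ?case using ideal_comp_right[OF M X _ f] adjoin_object.base by metis
    next
      \<comment> \<open>Associativity moves the outer morphism into \<open>f'\<close>, so the
        composite still goes through \<open>A\<close>.\<close>
      case (factor f' g)
      then show ?case
        using A X f by (simp add: comp_closed adjoin_object.factor flip: comp_assoc)
    next
      case (add h k)
      then show ?case
        using sub[OF add.hyps(1)] sub[OF add.hyps(2)] X f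
        by (simp add: comp_add_left adjoin_object.add)
    qed
    show "Comp C U V Y g i \<in> adjoin_object C M A U Y"
      if Y: "Y \<in> Obj C" and i: "i \<in> adjoin_object C M A U V" and g: "g \<in> Hom C V Y" for U V Y i g
      using i
    proof induction
      case (base m)
      then show ?case using ideal_comp_left[OF M Y _ g] adjoin_object.base by metis
    next
      case (factor f' g')
      then show ?case
        using A Y g by (simp add: comp_closed adjoin_object.factor comp_assoc)
    next
      case (add h k)
      then show ?case
        using sub[OF add.hyps(1)] sub[OF add.hyps(2)] Y g
        by (simp add: comp_add_right adjoin_object.add)
    qed
    show "X \<in> Obj C \<and> Y \<in> Obj C \<and> h \<in> Hom C X Y" if "h \<in> adjoin_object C M A X Y" for X Y h
      using sub[OF that] .
  qed (rule adjoin_object.add)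
qed

text \<open>The identity of \<open>A\<close> factors through \<open>A\<close>, so the enlarged ideal
  strictly contains \<open>M\<close>, and maximality leaves only the improper ideal.\<close>

lemma adjoin_object_eq_hom:
  assumes "maximal_ideal C M" "A \<in> Obj C" "M A A \<noteq> Hom C A A"
  shows "adjoin_object C M A = hom_ideal C"
proof (rule ccontr)
  assume "adjoin_object C M A \<noteq> hom_ideal C"
  moreover note M = maximal_imp_ideal[OF assms(1)]
  ultimately have "proper_ideal C (adjoin_object C M A)"
    using ideal_adjoin_object[OF M assms(2)] by (simp add: proper_ideal_def)
  moreover have "M \<le> adjoin_object C M A"
    by (auto simp: le_fun_def intro: adjoin_object.base)
  ultimately have "adjoin_object C M A = M"
    using maximal_ideal_eqI[OF assms(1)] by blast
  moreover have "Ident C A \<in> adjoin_object C M A A A"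
    using adjoin_object.factor[of A C A "Ident C A" A "Ident C A" M] assms(2)
      ident_closed[of A] comp_ident_left[of A A] by simp
  ultimately show False
    using ideal_eq_hom_iff[OF M assms(2)] assms(3) by simp
qed

text \<open>For \<open>h = m + \<Sum>\<^sub>i g\<^sub>i f\<^sub>i\<close>, the set \<open>F\<close> consists of the \<open>g\<^sub>i\<close>.\<close>

lemma adjoin_object_finite_support:
  assumes M: "cat_ideal C M" and A: "A \<in> Obj C" and h: "h \<in> adjoin_object C M A X Y"
  shows "\<exists>F. finite F \<and> F \<subseteq> Hom C A Y \<and>
    (\<forall>f\<in>Hom C Y A. (\<forall>\<phi>\<in>F. Comp C A Y A f \<phi> = Zero C A A) \<longrightarrow> Comp C X Y A f h \<in> M X A)"
  using h
proof induction
  case (base m)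
  then show ?case using ideal_comp_left[OF M A] by (intro exI[of _ "{}"]) auto
next
  case (factor f' g)
  \<comment> \<open>Here f (g f') = (f g) f' = 0.\<close>
  have "Comp C X Y A f (Comp C X A Y g f') \<in> M X A"
    if "f \<in> Hom C Y A" "Comp C A Y A f g = Zero C A A" for f
    using that factor A comp_assoc[of X A Y A f' g f] by (simp add: comp_zero_left ideal_zero[OF M])
  then show ?case using factor by (intro exI[of _ "{g}"]) auto
next
  case (add h k)
  obtain F G where F: "finite F" "F \<subseteq> Hom C A Y"
      "\<forall>f\<in>Hom C Y A. (\<forall>\<phi>\<in>F. Comp C A Y A f \<phi> = Zero C A A) \<longrightarrow> Comp C X Y A f h \<in> M X A"
    and G: "finite G" "G \<subseteq> Hom C A Y"
      "\<forall>f\<in>Hom C Y A. (\<forall>\<phi>\<in>G. Comp C A Y A f \<phi> = Zero C A A) \<longrightarrow> Comp C X Y A f k \<in> M X A"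
    using add.IH by blast
  have hk: "X \<in> Obj C" "Y \<in> Obj C" "h \<in> Hom C X Y" "k \<in> Hom C X Y"
    using add.hyps ideal_subset[OF ideal_adjoin_object[OF M A]] by blast+
  have "Comp C X Y A f (Add C X Y h k) \<in> M X A"
    if "f \<in> Hom C Y A" "\<forall>\<phi>\<in>F \<union> G. Comp C A Y A f \<phi> = Zero C A A" for f
    using that F(3) G(3) hk A comp_add_right[of X Y A h k f] by (simp add: ideal_add[OF M])
  then show ?case using F G by (intro exI[of _ "F \<union> G"]) auto
qed

section \<open>The relation \<prec> and the objects at which a maximal ideal is proper\<close>

lemma obj_prec_annihilator:
  assumes "obj_prec C A B" "finite F" "F \<subseteq> Hom C A B"
  obtains f g where "f \<in> Hom C B A" "g \<in> Hom C A B" "Comp C A B A f g = Ident C A"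
    "\<And>\<phi>. \<phi> \<in> F \<Longrightarrow> Comp C A B A f \<phi> = Zero C A A"
proof -
  obtain E where E: "E \<subseteq> Hom C B A \<times> Hom C A B" "infinite E"
      "\<forall>(f, g)\<in>E. Comp C A B A f g = Ident C A"
      "\<forall>\<phi>\<in>Hom C A B. |{(f, g) \<in> E. Comp C A B A f \<phi> \<noteq> Zero C A A}| <o |E|"
    using assms(1) unfolding obj_prec_def by blast
  define bad where "bad \<phi> = {(f, g) \<in> E. Comp C A B A f \<phi> \<noteq> Zero C A A}" for \<phi>
  \<comment> \<open>As \<open>E\<close> is infinite, a finite union of sets of cardinality below |E|
    stays below it. Hence some pair of \<open>E\<close> avoids all the bad sets.\<close>
  have "|\<Union>\<phi>\<in>F. bad \<phi>| <o |E|"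
    using assms(2,3)
  proof (induction F rule: finite_induct)
    case empty
    have "|{}| <o |E|"
      using E(2) by (intro finite_ordLess_infinite card_of_Well_order) (simp_all add: Field_card_of)
    then show ?case by simp
  next
    case (insert \<phi> F)
    then have "|bad \<phi>| <o |E|" "|\<Union>\<phi>\<in>F. bad \<phi>| <o |E|"
      using E(4) by (auto simp: bad_def)
    then show ?case
      using card_of_Un_ordLess_infinite[OF E(2)] by simp
  qed
  then have "\<not> E \<subseteq> (\<Union>\<phi>\<in>F. bad \<phi>)"
    using card_of_mono1 not_ordLess_ordLeq by blast
  then obtain f g where fg: "(f, g) \<in> E" "(f, g) \<notin> (\<Union>\<phi>\<in>F. bad \<phi>)"
    by auto
  show thesis
  proof (rule that)
    show "f \<in> Hom C B A" "g \<in> Hom C A B" "Comp C A B A f g = Ident C A"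
      using E(1,3) fg(1) by auto
    show "Comp C A B A f \<phi> = Zero C A A" if "\<phi> \<in> F" for \<phi>
      using that fg by (auto simp: bad_def)
  qed
qed

lemma maximal_ideal_imp_maximal_object:
  assumes max: "maximal_ideal C M" and A: "A \<in> Obj C" "M A A \<noteq> Hom C A A"
  shows "maximal_object C A"
proof (rule ccontr)
  note M = maximal_imp_ideal[OF max]
  assume "\<not> maximal_object C A"
  then obtain B where B: "B \<in> Obj C" "obj_prec C A B"
    using A(1) by (auto simp: maximal_object_def)
  \<comment> \<open>Maximality puts 1_B into the ideal generated by \<open>M\<close> and 1_A, so 1_B
    has a finite support \<open>F\<close>.\<close>
  have "Ident C B \<in> adjoin_object C M A B B"
    using B(1) ident_closed by (simp add: adjoin_object_eq_hom[OF max A] hom_ideal_def)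
  from adjoin_object_finite_support[OF M A(1) this] obtain F where F:
      "finite F" "F \<subseteq> Hom C A B"
      "\<And>f. f \<in> Hom C B A \<Longrightarrow> \<forall>\<phi>\<in>F. Comp C A B A f \<phi> = Zero C A A
        \<Longrightarrow> Comp C B B A f (Ident C B) \<in> M B A"
    by blast
  obtain f g where fg: "f \<in> Hom C B A" "g \<in> Hom C A B" "Comp C A B A f g = Ident C A"
      "\<And>\<phi>. \<phi> \<in> F \<Longrightarrow> Comp C A B A f \<phi> = Zero C A A"
    using obj_prec_annihilator[OF B(2) F(1,2)] by blast
  \<comment> \<open>Since \<open>f\<close> kills \<open>F\<close>, the composite f 1_B lies in
    \<open>M\<close>; then so does 1_A = f g.\<close>
  have "f \<in> M B A"
    using F(3)[OF fg(1)] fg(4) comp_ident_right[OF B(1) A(1) fg(1)] by simp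
  then have "Comp C A B A f g \<in> M A A"
    using ideal_comp_right[OF M A(1) _ fg(2)] by blast
  then show False
    using fg(3) ideal_eq_hom_iff[OF M A(1)] A(2) by simp
qed

section \<open>Restriction to and extension from a full subcategory\<close>

lemma ident_in_ideal_if_adjoined:
  assumes "maximal_ideal C M" "A \<in> Obj C" "M A A \<noteq> Hom C A A"
    and J: "cat_ideal (full_subcat C S) J" "S \<subseteq> Obj C" "A \<in> S" "X \<in> S"
    and le: "restrict_ideal (full_subcat C S) M \<le> J" and id: "Ident C A \<in> J A A"
  shows "Ident C X \<in> J X X"
proof -
  interpret S: preadditive_category "full_subcat C S"
    using preadditive_full_subcat[OF J(2)] .
  \<comment> \<open>Writing 1_X as a sum over \<open>M\<close> and \<open>A\<close> involves only
    the objects \<open>X\<close> and \<open>A\<close>, both in \<open>S\<close>, so it can be read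
    inside the subcategory. There \<open>J\<close> contains \<open>M\<close> and, through 1_A, all
    that factors through \<open>A\<close>.\<close>
  have "h \<in> J X X" if "h \<in> adjoin_object C M A X X" for h
    using that
  proof induction
    case (base m)
    then show ?case
      using le_funD[OF le_funD[OF le], of X X] J(4) by (auto simp: restrict_ideal_apply)
  next
    case (factor f g)
    then have "Comp C X A A (Ident C A) f \<in> J X A"
      using S.ideal_comp_right[OF J(1) _ id, of X f] J(4) by simp
    then have "f \<in> J X A"
      using comp_ident_left[of X A f] factor assms(2) by simp
    then show ?case
      using S.ideal_comp_left[OF J(1), of X f X A g] J(4) factor by simp
  next
    case (add h k)
    then show ?case using S.ideal_add[OF J(1)] by simp
  qed
  moreover have "Ident C X \<in> adjoin_object C M A X X"
    using J(2,4) ident_closed by (auto simp: adjoin_object_eq_hom[OF assms(1-3)] hom_ideal_def)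
  ultimately show ?thesis by blast
qed

lemma ideal_restrict:
  assumes "cat_ideal C I" "S \<subseteq> Obj C"
  shows "cat_ideal (full_subcat C S) (restrict_ideal (full_subcat C S) I)"
proof -
  have "\<And>X. X \<in> S \<Longrightarrow> X \<in> Obj C" using assms(2) by blast
  then show ?thesis
    using assms(1) by (simp add: cat_ideal_def restrict_ideal_def)
qed

text \<open>The defining condition at X, Y mentions only hom-sets among X, Y and \<open>A\<close>,
  which a full subcategory leaves unchanged.\<close>

lemma restrict_associated:
  assumes "S \<subseteq> Obj C"
  shows "restrict_ideal (full_subcat C S) (associated_ideal C A I)
    = associated_ideal (full_subcat C S) A I"
  using assms by (auto simp: restrict_ideal_def associated_ideal_def fun_eq_iff)

text \<open>A larger ideal \<open>J\<close> is tested on 1_A. If it contains 1_A, it contains every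
  identity of the subcategory; otherwise \<open>J A A\<close> has \<open>M\<close> as its associated
  ideal, which forces \<open>J\<close> back into the restriction.\<close>

lemma maximal_restrict:
  assumes max: "maximal_ideal C M" and S: "S \<subseteq> Obj C" and A: "A \<in> S" "M A A \<noteq> Hom C A A"
  shows "maximal_ideal (full_subcat C S) (restrict_ideal (full_subcat C S) M)"
    (is "maximal_ideal ?D ?M")
proof -
  interpret S: preadditive_category ?D
    using preadditive_full_subcat[OF S] .
  note M = maximal_imp_ideal[OF max]
  have AC: "A \<in> Obj C" using A S by blast
  have MA: "?M A A = M A A" using A(1) by (simp add: restrict_ideal_def)
  have "proper_ideal ?D ?M"
    using S.proper_idealI[OF ideal_restrict[OF M S], of A] A MA by simp
  moreover have False if J: "proper_ideal ?D J" "?M < J" for J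
  proof -
    have J': "cat_ideal ?D J" using J(1) by (simp add: proper_ideal_def)
    have le: "?M \<le> J" using J(2) by simp
    show False
    proof (cases "Ident C A \<in> J A A")
      case True
      then have "J = hom_ideal ?D"
        using ident_in_ideal_if_adjoined[OF max AC A(2) J' S A(1) _ le True]
          S.ideal_eq_hom_idealI[OF J'] by simp
      then show False
        using J(1) by (simp add: proper_ideal_def)
    next
      case False
      have "M A A \<subseteq> J A A"
        using le MA by (metis le_funD)
      moreover have "subgroup (J A A) (hom_group C A A)"
        using S.ideal_subgroup[OF J', of A A] A(1) by simp
      \<comment> \<open>Maximality of \<open>M\<close> is used in the whole category, although
        \<open>J\<close> lives on \<open>S\<close> only: the value \<open>J A A\<close> alone
        defines an ideal of \<open>C\<close>.\<close>
      ultimately have "associated_ideal C A (J A A) = M"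
        using maximal_ideal_eq_associated[OF max AC] False by blast
      then have "associated_ideal ?D A (J A A) = ?M"
        using restrict_associated[OF S] by metis
      then have "J \<le> ?M"
        using S.ideal_le_associated[OF J', of A "J A A"] A(1) by simp
      then show False using J(2) by simp
    qed
  qed
  ultimately show ?thesis by (auto simp: maximal_ideal_def)
qed

text \<open>The restricted ideal is the associated ideal formed within the subcategory, where a
  maximal ideal is recovered from its value at \<open>A\<close>.\<close>

lemma restrict_extension:
  assumes max: "maximal_ideal (full_subcat C S) M" and S: "S \<subseteq> Obj C"
    and A: "A \<in> S" "M A A \<noteq> Hom C A A"
  shows "restrict_ideal (full_subcat C S) (associated_ideal C A (M A A)) = M"
proof -
  interpret S: preadditive_category "full_subcat C S"
    using preadditive_full_subcat[OF S] .
  show ?thesis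
    using S.maximal_ideal_eq_associated_self[OF max, of A] A restrict_associated[OF S] by simp
qed

text \<open>An ideal strictly above the extension restricts to everything on \<open>S\<close>. The
  premise \<open>cover\<close> lists the two ways in which it then acquires the identity of an
  object outside \<open>S\<close>: by a retraction from an object of \<open>S\<close>, or already
  from the extension.\<close>

lemma maximal_extension:
  assumes max: "maximal_ideal (full_subcat C S) M" and S: "S \<subseteq> Obj C"
    and A: "A \<in> S" "M A A \<noteq> Hom C A A"
    and cover: "\<And>X. X \<in> Obj C \<Longrightarrow> X \<notin> S \<Longrightarrow>
      (\<exists>N\<in>S. \<exists>f\<in>Hom C N X. \<exists>g\<in>Hom C X N. Comp C X N X f g = Ident C X) \<or>
      associated_ideal C A (M A A) X X = Hom C X X"
  shows "maximal_ideal C (associated_ideal C A (M A A))" (is "maximal_ideal C ?M")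
proof -
  let ?D = "full_subcat C S"
  interpret S: preadditive_category ?D
    using preadditive_full_subcat[OF S] .
  note M = maximal_imp_ideal[OF max]
  have AC: "A \<in> Obj C" using A S by blast
  have id: "Ident C A \<notin> M A A"
    using S.ideal_eq_hom_iff[OF M, of A] A by simp
  have sub: "subgroup (M A A) (hom_group C A A)"
    using S.ideal_subgroup[OF M, of A A] A(1) by simp
  have M': "cat_ideal C ?M"
    using ideal_associated[OF sub AC] .
  have "proper_ideal C ?M"
    using proper_idealI[OF M' AC associated_neq_hom[OF AC id]] .
  moreover have False if J: "proper_ideal C J" "?M < J" for J
  proof -
    have J': "cat_ideal C J" using J(1) by (simp add: proper_ideal_def)
    let ?J = "restrict_ideal ?D J"
    have le: "?M \<le> J" using J(2) by simp
    have M_le: "M \<le> ?J"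
      using restrict_ideal_mono[OF le, of ?D] restrict_extension[OF max S A] by simp
    \<comment> \<open>Strictness survives restriction: an ideal with value \<open>M A A\<close> at
      \<open>A\<close> lies in the associated ideal.\<close>
    have "?J \<noteq> M"
    proof
      assume "?J = M"
      then have "J A A = M A A"
        using A(1) restrict_ideal_apply[of A ?D A J] by simp
      then have "J \<le> ?M"
        using ideal_le_associated[OF J' AC] by simp
      then show False using J(2) by simp
    qed
    then have "?J = hom_ideal ?D"
      using maximal_ideal_eqI[OF max _ M_le] ideal_restrict[OF J' S]
      by (auto simp: proper_ideal_def)
    then have "J X X = Hom C X X" if "X \<in> S" for X
      using that restrict_ideal_apply[of X ?D X J] by (simp add: hom_ideal_def)
    then have in_S: "Ident C X \<in> J X X" if "X \<in> S" for X
      using that S ident_closed by blast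
    have "Ident C X \<in> J X X" if X: "X \<in> Obj C" for X
    proof (cases "X \<in> S")
      case False
      from cover[OF X this] show ?thesis
      proof
        assume "associated_ideal C A (M A A) X X = Hom C X X"
        then show ?thesis
          using le ident_closed[OF X] by (auto simp: le_fun_def)
      next
        assume "\<exists>N\<in>S. \<exists>f\<in>Hom C N X. \<exists>g\<in>Hom C X N. Comp C X N X f g = Ident C X"
        then obtain N f g where N: "N \<in> S" "f \<in> Hom C N X" "g \<in> Hom C X N"
            "Comp C X N X f g = Ident C X"
          by blast
        \<comment> \<open>Here 1_X = f g = f 1_N g.\<close>
        have "Comp C X N X f (Comp C X N N (Ident C N) g) \<in> J X X"
          using ideal_comp[OF J' X X N(3) in_S[OF N(1)] N(2)] .
        then show ?thesis
          using N S X comp_ident_left[of X N g] by auto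
      qed
    qed (rule in_S)
    then show False
      using ideal_eq_hom_idealI[OF J'] J(1) by (simp add: proper_ideal_def)
  qed
  ultimately show ?thesis by (auto simp: maximal_ideal_def)
qed

section \<open>The full subcategory of maximal objects\<close>

lemma maximal_idealE_in_M_cat:
  assumes "maximal_ideal C M"
  obtains A where "A \<in> Obj (M_cat C)" "M A A \<noteq> Hom C A A"
proof -
  obtain A where "A \<in> Obj C" "M A A \<noteq> Hom C A A"
    using assms proper_idealE unfolding maximal_ideal_def by blast
  then show thesis
    using that maximal_ideal_imp_maximal_object[OF assms] by (auto simp: M_cat_def)
qed

text \<open>Whichever object the extension picks, \<open>M\<close> is proper there and is the ideal
  associated to its value at that object.\<close>

lemma extend_restrict_maximal:
  assumes "maximal_ideal C M"
  shows "extend_ideal C (M_cat C) (restrict_ideal (M_cat C) M) = M"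
proof -
  let ?M = "restrict_ideal (M_cat C) M"
  obtain B where "B \<in> Obj (M_cat C)" "M B B \<noteq> Hom C B B"
    using maximal_idealE_in_M_cat[OF assms] .
  then have "\<exists>A\<in>Obj (M_cat C). ?M A A \<noteq> Hom (M_cat C) A A"
    by (auto simp: restrict_ideal_apply M_cat_def)
  then obtain A where A: "A \<in> Obj (M_cat C)" "?M A A \<noteq> Hom (M_cat C) A A"
      "extend_ideal C (M_cat C) ?M = associated_ideal C A (?M A A)"
    by (rule extend_idealE)
  have "?M A A = M A A" "A \<in> Obj C" "Hom (M_cat C) A A = Hom C A A"
    using A(1) by (auto simp: restrict_ideal_def M_cat_def)
  then show ?thesis
    using A maximal_ideal_eq_associated_self[OF assms] by simp
qed

lemma restrict_maximal:
  assumes "maximal_ideal C M"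
  shows "maximal_ideal (M_cat C) (restrict_ideal (M_cat C) M)"
    and "extension_covers_rest C (restrict_ideal (M_cat C) M)"
proof -
  obtain A where "A \<in> Obj (M_cat C)" "M A A \<noteq> Hom C A A"
    using maximal_idealE_in_M_cat[OF assms] .
  then show "maximal_ideal (M_cat C) (restrict_ideal (M_cat C) M)"
    using maximal_restrict[OF assms] by (simp add: M_cat_def)
  \<comment> \<open>The extension is \<open>M\<close> again, and \<open>M\<close> is improper at
    every nonmaximal object.\<close>
  show "extension_covers_rest C (restrict_ideal (M_cat C) M)"
    using maximal_ideal_imp_maximal_object[OF assms] extend_restrict_maximal[OF assms]
    by (auto simp: extension_covers_rest_def M_cat_def)
qed

lemma extend_maximal:
  assumes max: "maximal_ideal (M_cat C) M" and covers: "extension_covers_rest C M"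
  shows "maximal_ideal C (extend_ideal C (M_cat C) M)"
    and "restrict_ideal (M_cat C) (extend_ideal C (M_cat C) M) = M"
proof -
  define S where "S = Obj (M_cat C)"
  have S: "S \<subseteq> Obj C" "M_cat C = full_subcat C S"
    by (auto simp: S_def M_cat_def)
  interpret S: preadditive_category "M_cat C"
    unfolding S(2) by (rule preadditive_full_subcat[OF S(1)])
  have "proper_ideal (M_cat C) M"
    using max by (simp add: maximal_ideal_def)
  then have "\<exists>A\<in>Obj (M_cat C). M A A \<noteq> Hom (M_cat C) A A"
    by (rule S.proper_idealE) blast
  then obtain A where "A \<in> Obj (M_cat C)" "M A A \<noteq> Hom (M_cat C) A A"
      and ext: "extend_ideal C (M_cat C) M = associated_ideal C A (M A A)"
    by (rule extend_idealE)
  then have A: "A \<in> S" "M A A \<noteq> Hom C A A"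
    by (simp_all add: S(2))
  \<comment> \<open>Verifies the covering premise: objects of S(C) are retracts of maximal ones, and
    the condition of class (2) settles the others.\<close>
  have "(\<exists>N\<in>S. \<exists>f\<in>Hom C N X. \<exists>g\<in>Hom C X N. Comp C X N X f g = Ident C X) \<or>
      associated_ideal C A (M A A) X X = Hom C X X" if X: "X \<in> Obj C" "X \<notin> S" for X
  proof (cases "X \<in> Obj (S_cat C)")
    case True
    then obtain N where N: "N \<in> S" "obj_prec C X N"
      by (auto simp: S_cat_def S_def)
    \<comment> \<open>With no morphisms to annihilate, the choice of a pair from the witnessing set
      just gives a retraction.\<close>
    obtain f g where "f \<in> Hom C N X" "g \<in> Hom C X N" "Comp C X N X f g = Ident C X"
      using obj_prec_annihilator[OF N(2), of "{}"] by blast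
    then show ?thesis
      using N(1) by blast
  next
    case False
    then show ?thesis
      using X covers by (simp add: extension_covers_rest_def ext S_def)
  qed
  then show "maximal_ideal C (extend_ideal C (M_cat C) M)"
    unfolding ext using maximal_extension[of S M A] max S A by simp
  show "restrict_ideal (M_cat C) (extend_ideal C (M_cat C) M) = M"
    unfolding ext using restrict_extension[of S M A] max S A by simp
qed

end

theorem theorem3p9:
  fixes C :: "('o, 'm) cat_data"
  assumes "preadditive_category C"
  shows "bij_betw (restrict_ideal (M_cat C))
      {M. maximal_ideal C M}
      {M. maximal_ideal (M_cat C) M \<and> extension_covers_rest C M} \<and>
    bij_betw (extend_ideal C (M_cat C))
      {M. maximal_ideal (M_cat C) M \<and> extension_covers_rest C M}
      {M. maximal_ideal C M} \<and>
    (\<forall>M. maximal_ideal C M \<longrightarrow>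
      extend_ideal C (M_cat C) (restrict_ideal (M_cat C) M) = M) \<and>
    (\<forall>M. maximal_ideal (M_cat C) M \<and> extension_covers_rest C M \<longrightarrow>
      restrict_ideal (M_cat C) (extend_ideal C (M_cat C) M) = M)"
proof -
  interpret preadditive_category C by fact
  show ?thesis
  proof (intro conjI)
    \<comment> \<open>Each assignment maps into the other class and is inverse to the other, so each
      witnesses the bijectivity of the other.\<close>
    show "bij_betw (restrict_ideal (M_cat C)) {M. maximal_ideal C M}
        {M. maximal_ideal (M_cat C) M \<and> extension_covers_rest C M}"
      by (rule bij_betw_byWitness[where f' = "extend_ideal C (M_cat C)"])
        (auto simp: extend_restrict_maximal extend_maximal restrict_maximal)
    show "bij_betw (extend_ideal C (M_cat C))
        {M. maximal_ideal (M_cat C) M \<and> extension_covers_rest C M} {M. maximal_ideal C M}"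
      by (rule bij_betw_byWitness[where f' = "restrict_ideal (M_cat C)"])
        (auto simp: extend_restrict_maximal extend_maximal restrict_maximal)
  qed (simp_all add: extend_restrict_maximal extend_maximal)
qed

end
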